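(* Let $C^{ijkl}$ be any elasticity tensor in three dimensions, $\rho>0$, and $n=(n_1,n_2,n_3)$ any (unit) wave covector. Let $A^{ijkl}:=C^{ijkl}-C^{(ijkl)}$ and let $\mathcal A^{il}:=\frac1\rho A^{ijkl}n_jn_k$ be the non-Cauchy Christoffel tensor. Then $\mathcal A^{il}n_l=0$ for all $i$.
   Context: Indices run over $1,2,3$; summation over repeated indices. An elasticity tensor is a real fourth-rank tensor $C^{ijkl}$ on $\mathbb R^3$ with $C^{ijkl}=C^{jikl}$, $C^{ijkl}=C^{ijlk}$ (minor symmetries) and $C^{ijkl}=C^{klij}$ (major symmetry). $C^{(ijkl)}$ is $\frac1{4!}$ times the sum over all permutations of the indices. $\rho$ is the mass density. *)

theory Defs
  imports "HOL-Analysis.Analysis"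
begin

type_synonym tensor4 = "real ^ 3 ^ 3 ^ 3 ^ 3"

definition elasticity_tensor :: "tensor4 \<Rightarrow> bool" where
  "elasticity_tensor C \<longleftrightarrow>
     (\<forall>i j k l. C $ i $ j $ k $ l = C $ j $ i $ k $ l) \<and>
     (\<forall>i j k l. C $ i $ j $ k $ l = C $ i $ j $ l $ k) \<and>
     (\<forall>i j k l. C $ i $ j $ k $ l = C $ k $ l $ i $ j)"

(* The permutation p acts on the four index positions 0, 1, 2, 3, so the sum has 4! terms
   even if some of the indices i, j, k, l coincide. *)
definition symmetric_part :: "tensor4 \<Rightarrow> tensor4" where
  "symmetric_part C = (\<chi> i j k l.
     (\<Sum>p | p permutes {..<4::nat}.
        C $ ([i, j, k, l] ! p 0) $ ([i, j, k, l] ! p 1) $ ([i, j, k, l] ! p 2) $ ([i, j, k, l] ! p 3))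
     / fact 4)"

definition non_Cauchy_part :: "tensor4 \<Rightarrow> tensor4" where
  "non_Cauchy_part C = C - symmetric_part C"

definition christoffel :: "real \<Rightarrow> tensor4 \<Rightarrow> real ^ 3 \<Rightarrow> real ^ 3 ^ 3" where
  "christoffel \<rho> T n =
     (\<chi> i l. 1 / \<rho> * (\<Sum>j\<in>UNIV. \<Sum>k\<in>UNIV. T $ i $ j $ k $ l * n $ j * n $ k))"

definition non_Cauchy_christoffel :: "real \<Rightarrow> tensor4 \<Rightarrow> real ^ 3 \<Rightarrow> real ^ 3 ^ 3" where
  "non_Cauchy_christoffel \<rho> C n = christoffel \<rho> (non_Cauchy_part C) n"

end

theory Submission
  imports Defs
begin

text \<open>The minor and major symmetries reduce the symmetric part to
  \<open>(C\<^sup>i\<^sup>j\<^sup>k\<^sup>l + C\<^sup>i\<^sup>k\<^sup>j\<^sup>l + C\<^sup>i\<^sup>l\<^sup>j\<^sup>k) / 3\<close>. Contracting the last three indices with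
  copies of \<open>n\<close> forgets their order, so the three terms have equal contractions and the symmetric
  part contributes exactly as much as \<open>C\<close> itself.\<close>

lemma symmetric_part_elasticity:
  assumes "elasticity_tensor C"
  shows "symmetric_part C $ i $ j $ k $ l
    = (C $ i $ j $ k $ l + C $ i $ k $ j $ l + C $ i $ l $ j $ k) / 3"
proof -
  have minor: "C $ a $ b $ c $ d = C $ b $ a $ c $ d" "C $ a $ b $ c $ d = C $ a $ b $ d $ c"
    and major: "C $ a $ b $ c $ d = C $ c $ d $ a $ b" for a b c d
    using assms unfolding elasticity_tensor_def by blast+
  \<comment> \<open>The 24 index orders split into three classes of eight, according to which index
    is paired with \<open>i\<close>. The \<open>minor\<close> instances link the orders within each
    half of a class, and one \<open>major\<close> instance joins the two halves.\<close>
  note eqs = minor[of i j k l] minor[of i j l k] minor[of j i k l] minor[of j i l k]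
    minor[of k l i j] minor[of k l j i] minor[of l k i j] minor[of l k j i]
    minor[of i k j l] minor[of i k l j] minor[of k i j l] minor[of k i l j]
    minor[of j l i k] minor[of j l k i] minor[of l j i k] minor[of l j k i]
    minor[of i l j k] minor[of i l k j] minor[of l i j k] minor[of l i k j]
    minor[of j k i l] minor[of j k l i] minor[of k j i l] minor[of k j l i]
    major[of i j k l] major[of i k j l] major[of i l j k]
  \<comment> \<open>In insertion form, \<open>sum_over_permutations_insert\<close> can expand the
    sum into explicit terms.\<close>
  have "{..<4::nat} = {0, 1, 2, 3}" by auto
  then show ?thesis
    unfolding symmetric_part_def
    apply (simp add: sum_over_permutations_insert transpose_def fact_numeral)
    using eqs by linarith
qed

lemma contract_symmetric_part:
  assumes "elasticity_tensor C"
  shows "(\<Sum>j\<in>UNIV. \<Sum>k\<in>UNIV. \<Sum>l\<in>UNIV. symmetric_part C $ i $ j $ k $ l * n $ j * n $ k * n $ l)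
    = (\<Sum>j\<in>UNIV. \<Sum>k\<in>UNIV. \<Sum>l\<in>UNIV. C $ i $ j $ k $ l * n $ j * n $ k * n $ l)"
proof -
  let ?Q = "\<lambda>D. \<Sum>j\<in>UNIV. \<Sum>k\<in>UNIV. \<Sum>l\<in>UNIV. D j k l * n $ j * n $ k * n $ l"
  have swap12: "?Q (\<lambda>j k l. D k j l) = ?Q D" for D :: "3 \<Rightarrow> 3 \<Rightarrow> 3 \<Rightarrow> real"
    by (subst sum.swap) (simp add: mult_ac)
  have swap23: "?Q (\<lambda>j k l. D j l k) = ?Q D" for D :: "3 \<Rightarrow> 3 \<Rightarrow> 3 \<Rightarrow> real"
    by (rule sum.cong[OF refl], subst sum.swap) (simp add: mult_ac)
  let ?D = "\<lambda>j k l. C $ i $ j $ k $ l"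
  \<comment> \<open>The cyclic shift is a composite of the two adjacent swaps.\<close>
  have cycle: "?Q (\<lambda>j k l. ?D l j k) = ?Q ?D"
    using swap12[of ?D] swap23[of "\<lambda>j k l. ?D k j l"] by simp
  have "?Q (\<lambda>j k l. symmetric_part C $ i $ j $ k $ l)
      = (?Q ?D + ?Q (\<lambda>j k l. ?D k j l) + ?Q (\<lambda>j k l. ?D l j k)) / 3"
    by (simp add: symmetric_part_elasticity[OF assms] sum_divide_distrib distrib_right
        add_divide_distrib sum.distrib)
  then show ?thesis
    unfolding swap12[of ?D] cycle by simp
qed

text \<open>Moving the sum over \<open>l\<close> innermost gives the contraction the shape used in
  \<open>contract_symmetric_part\<close>.\<close>

lemma christoffel_mult_covector:
  "(\<Sum>l\<in>UNIV. christoffel \<rho> T n $ i $ l * n $ l)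
    = 1 / \<rho> * (\<Sum>j\<in>UNIV. \<Sum>k\<in>UNIV. \<Sum>l\<in>UNIV. T $ i $ j $ k $ l * n $ j * n $ k * n $ l)"
proof -
  have "(\<Sum>l\<in>UNIV. christoffel \<rho> T n $ i $ l * n $ l)
      = 1 / \<rho> * (\<Sum>l\<in>UNIV. \<Sum>j\<in>UNIV. \<Sum>k\<in>UNIV. T $ i $ j $ k $ l * n $ j * n $ k * n $ l)"
    by (simp add: christoffel_def sum_distrib_right sum_divide_distrib)
  also have "(\<Sum>l\<in>UNIV. \<Sum>j\<in>UNIV. \<Sum>k\<in>UNIV. T $ i $ j $ k $ l * n $ j * n $ k * n $ l)
      = (\<Sum>j\<in>UNIV. \<Sum>l\<in>UNIV. \<Sum>k\<in>UNIV. T $ i $ j $ k $ l * n $ j * n $ k * n $ l)"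
    by (rule sum.swap)
  also have "\<dots> = (\<Sum>j\<in>UNIV. \<Sum>k\<in>UNIV. \<Sum>l\<in>UNIV. T $ i $ j $ k $ l * n $ j * n $ k * n $ l)"
    by (rule sum.cong[OF refl], rule sum.swap)
  finally show ?thesis .
qed

theorem proposition13:
  fixes C :: tensor4 and \<rho> :: real and n :: "real ^ 3"
  assumes "elasticity_tensor C" and "\<rho> > 0"
  shows "\<forall>i. (\<Sum>l\<in>UNIV. non_Cauchy_christoffel \<rho> C n $ i $ l * n $ l) = 0"
  \<comment> \<open>By linearity, the contraction of \<open>non_Cauchy_part C\<close> is the
    difference of the two sides of this equation.\<close>
  using contract_symmetric_part[OF assms(1), of _ n]
  by (simp add: non_Cauchy_christoffel_def christoffel_mult_covector non_Cauchy_part_def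
      left_diff_distrib sum_subtractf)

end
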